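(* Let $X=(X_n)_{n\ge 0}$ be a stationary stochastic process over a finite alphabet $\mathcal{A}$ with stationary measure $\mu$ on $\mathcal{A}^{\mathbb{N}}$, and let $f$ be the run-length encoder. Assume that $\underline{H}_2(f_*\mu)>0$ and that there exist $c>0$ and $h>0$ such that for every $n\ge 1$ and every $a\in\mathcal{A}$, $$\mu(\underbrace{a\cdots a}_{n})\le c\,e^{-hn}.$$ Then for $\mu\otimes\mu$-almost every pair $(\mathbf{x},\mathbf{y})$, $$\limsup_{n\to\infty}\frac{M_n^{RLE}(\mathbf{x},\mathbf{y})}{\log n}\le \frac{2}{\underline{H}_2(f_*\mu)}.$$
   Context: Sequences are indexed from $0$. For a finite string $\omega$ of length $k$ over $\mathcal{A}$, $\mu(\omega)$ denotes $\mu(X_i^{i+k-1}=\omega)$, which does not depend on $i$ by stationarity; here $z_i^{i+k-1}=(z_i,\dots,z_{i+k-1})$. Run-length encoder: let $\mathcal{B}=\{(\alpha,k):\alpha\in\mathcal{A},\ k\in\mathbb{N},\ k\ge 1\}$. A sequence in $\mathcal{A}^{\mathbb{N}}$ that is not eventually constant is written uniquely as a concatenation of maximal runs, $\alpha_1$ repeated $k_1$ times, then $\alpha_2$ repeated $k_2$ times, and so on, with $\alpha_{i+1}\ne\alpha_i$ for all $i$. The encoder $f$ maps it to $(\alpha_1,k_1)(\alpha_2,k_2)\cdots\in\mathcal{B}^{\mathbb{N}}$. (Under the assumed exponential bound, $\mu$-almost every sequence is not eventually constant, so $f$ is defined $\mu$-a.e.) The pushforward measure is $f_*\mu(\cdot)=\mu(f^{-1}(\cdot))$.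 For $\omega\in\mathcal{B}^n$, $f_*\mu(\omega)$ is the $\mu$-probability that the first $n$ symbols of $f(X)$ are $\omega$. Longest common substring: for two sequences $\mathbf{u},\mathbf{v}$ over the same alphabet, $$M_n(\mathbf{u},\mathbf{v})=\max\{k:\ \mathbf{u}_i^{i+k-1}=\mathbf{v}_j^{j+k-1}\text{ for some }0\le i,j\le n-k\}$$ (with $k=0$ always allowed), that is, the greatest length of a common block contained in the first $n$ symbols of each sequence. Set $M_n^{RLE}(\mathbf{x},\mathbf{y}):=M_n(f(\mathbf{x}),f(\mathbf{y}))$. Lower and upper Rényi entropies of order $2$ of $P=f_*\mu$: $$\underline{H}_2(P)=\liminf_{n\to\infty}\Big(-\frac1n\log\sum_{\omega\in\mathcal{B}^n}P(\omega)^2\Big),\qquad \overline{H}_2(P)=\limsup_{n\to\infty}\Big(-\frac1n\log\sum_{\omega\in\mathcal{B}^n}P(\omega)^2\Big).$$ By convention $2/\infty=0$. *)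

theory Defs
  imports "HOL-Probability.Probability"
begin

text \<open>Sequences are functions on \<^typ>\<open>nat\<close>, finite strings are lists. All alphabets used here are
  countable and carry the discrete sigma-algebra.\<close>

abbreviation seq_space :: "(nat \<Rightarrow> 'b) measure" where
  "seq_space \<equiv> PiM UNIV (\<lambda>_. count_space UNIV)"

definition process_law :: "'w measure \<Rightarrow> (nat \<Rightarrow> 'w \<Rightarrow> 'b) \<Rightarrow> (nat \<Rightarrow> 'b) measure" where
  "process_law W X = distr W seq_space (\<lambda>w n. X n w)"

definition stationary_process :: "'w measure \<Rightarrow> (nat \<Rightarrow> 'w \<Rightarrow> 'b) \<Rightarrow> bool" where
  "stationary_process W X \<longleftrightarrow>
     prob_space W \<and>
     (\<forall>n. X n \<in> W \<rightarrow>\<^sub>M count_space UNIV) \<and>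
     (\<forall>t. process_law W (\<lambda>n. X (n + t)) = process_law W X)"

definition string_prob :: "(nat \<Rightarrow> 'b) measure \<Rightarrow> 'b list \<Rightarrow> real" where
  "string_prob P w = measure P {z \<in> space P. \<forall>i<length w. z i = w ! i}"

definition strings :: "'b set \<Rightarrow> nat \<Rightarrow> 'b list set" where
  "strings B n = {w. length w = n \<and> set w \<subseteq> B}"

definition run_alphabet :: "('a \<times> nat) set" where
  "run_alphabet = {(a, k). k \<ge> 1}"

definition eventually_constant :: "(nat \<Rightarrow> 'a) \<Rightarrow> bool" where
  "eventually_constant x \<longleftrightarrow> (\<exists>a N. \<forall>n\<ge>N. x n = a)"

text \<open>\<open>is_run_decomposition x r\<close>: the sequence \<open>x\<close> is the concatenation of the blocks
  ``\<open>fst (r i)\<close> repeated \<open>snd (r i)\<close> times'', and these runs are maximal.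
  The \<open>i\<close>-th run starts at the sum of the lengths of the preceding ones.\<close>

definition is_run_decomposition :: "(nat \<Rightarrow> 'a) \<Rightarrow> (nat \<Rightarrow> 'a \<times> nat) \<Rightarrow> bool" where
  "is_run_decomposition x r \<longleftrightarrow>
     (\<forall>i. r i \<in> run_alphabet) \<and>
     (\<forall>i. fst (r (Suc i)) \<noteq> fst (r i)) \<and>
     (\<forall>i. \<forall>j<snd (r i). x ((\<Sum>l<i. snd (r l)) + j) = fst (r i))"

lemma run_length_pos: "is_run_decomposition x r \<Longrightarrow> snd (r i) > 0"
proof -
  assume "is_run_decomposition x r"
  then have "r i \<in> run_alphabet" by (simp add: is_run_decomposition_def)
  then show ?thesis by (cases "r i") (simp add: run_alphabet_def)
qed

lemma run_symbol:
  "is_run_decomposition x r \<Longrightarrow> j < snd (r i) \<Longrightarrow> x ((\<Sum>l<i. snd (r l)) + j) = fst (r i)"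
  unfolding is_run_decomposition_def by blast

lemma run_decomposition_unique:
  assumes r: "is_run_decomposition x r" and q: "is_run_decomposition x q"
  shows "r = q"
proof
  have not_shorter: "snd (q i) \<le> snd (r i)"
    if "is_run_decomposition x r" "is_run_decomposition x q" "\<forall>l<i. r l = q l" for r q i
  proof (rule ccontr)
    let ?s = "\<Sum>l<i. snd (r l)"
    assume "\<not> snd (q i) \<le> snd (r i)"
    then have lt: "snd (r i) < snd (q i)" by simp
    have s: "(\<Sum>l<i. snd (q l)) = ?s" using that(3) by simp
    have "x (?s + snd (r i)) = fst (q i)"
      using run_symbol[OF that(2) lt] s by simp
    moreover have "x (?s + snd (r i)) = fst (r (Suc i))"
      using run_symbol[OF that(1) run_length_pos[OF that(1), of "Suc i"]] by simp
    moreover have "x ?s = fst (q i)"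
      using run_symbol[OF that(2) run_length_pos[OF that(2), of i]] s by simp
    moreover have "x ?s = fst (r i)"
      using run_symbol[OF that(1) run_length_pos[OF that(1), of i]] by simp
    ultimately have "fst (r (Suc i)) = fst (r i)" by simp
    then show False using that(1) by (simp add: is_run_decomposition_def)
  qed
  fix i
  show "r i = q i"
  proof (induction i rule: less_induct)
    case (less i)
    then have eq: "\<forall>l<i. r l = q l" by simp
    have "snd (r i) = snd (q i)"
      using not_shorter[OF r q eq] not_shorter[OF q r] eq by (simp add: eq_iff)
    moreover have "fst (r i) = x (\<Sum>l<i. snd (r l))"
      using run_symbol[OF r run_length_pos[OF r]] by simp
    moreover have "fst (q i) = x (\<Sum>l<i. snd (q l))"
      using run_symbol[OF q run_length_pos[OF q]] by simp
    moreover have "(\<Sum>l<i. snd (r l)) = (\<Sum>l<i. snd (q l))" using eq by simp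
    ultimately show ?case by (simp add: prod_eq_iff)
  qed
qed

lemma run_decomposition_exists:
  assumes "\<not> eventually_constant x"
  shows "\<exists>r. is_run_decomposition x r"
proof -
  define nxt where "nxt m = (LEAST k. m < k \<and> x k \<noteq> x m)" for m
  have ex: "\<exists>k. m < k \<and> x k \<noteq> x m" for m
  proof (rule ccontr)
    assume "\<not> (\<exists>k. m < k \<and> x k \<noteq> x m)"
    then have "\<forall>k\<ge>Suc m. x k = x m" by (auto simp: Suc_le_eq)
    then show False using assms unfolding eventually_constant_def by blast
  qed
  have nxt: "m < nxt m" "x (nxt m) \<noteq> x m" for m
    unfolding nxt_def using LeastI_ex[OF ex[of m]] by auto
  have const: "x k = x m" if "m \<le> k" "k < nxt m" for m k
    using not_less_Least[of k "\<lambda>k. m < k \<and> x k \<noteq> x m", folded nxt_def, OF that(2)] that(1)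
    by (cases "k = m") auto
  define s where "s i = (nxt ^^ i) 0" for i
  have s_Suc: "s (Suc i) = nxt (s i)" and s_0: "s 0 = 0" for i by (auto simp: s_def)
  define r where "r i = (x (s i), s (Suc i) - s i)" for i
  have sum: "(\<Sum>l<i. snd (r l)) = s i" for i
    by (induction i) (use nxt(1) in \<open>auto simp: r_def s_Suc s_0 less_imp_le\<close>)
  have "is_run_decomposition x r"
    unfolding is_run_decomposition_def sum
    using nxt const by (auto simp: r_def s_Suc run_alphabet_def Suc_le_eq)
  then show ?thesis by blast
qed

text \<open>The encoder is only meaningful on sequences that are not eventually constant; there the
  decomposition exists and is unique. The eventually constant sequences over a finite alphabet are
  countably many; they get a value outside of \<^term>\<open>run_alphabet\<close>, so that they never
  contribute to the probability of a nonempty string over \<^term>\<open>run_alphabet\<close>.\<close>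

definition rle :: "(nat \<Rightarrow> 'a) \<Rightarrow> nat \<Rightarrow> 'a \<times> nat" where
  "rle x = (if eventually_constant x then (\<lambda>_. (undefined, 0))
            else (THE r. is_run_decomposition x r))"

lemma rle_is_run_decomposition:
  assumes "\<not> eventually_constant x"
  shows "is_run_decomposition x (rle x)"
proof -
  obtain r where r: "is_run_decomposition x r" using run_decomposition_exists[OF assms] ..
  have "(THE r. is_run_decomposition x r) = r"
    by (rule the_equality[where P = "is_run_decomposition x", OF r])
      (rule run_decomposition_unique[OF _ r])
  with r assms show ?thesis by (simp add: rle_def)
qed

definition rle_pushforward :: "(nat \<Rightarrow> 'a) measure \<Rightarrow> (nat \<Rightarrow> 'a \<times> nat) measure" where
  "rle_pushforward \<mu> = distr \<mu> seq_space rle"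

text \<open>The set in the maximum is finite and contains \<open>0\<close>; \<open>i + k \<le> n\<close> avoids truncated subtraction.\<close>

definition longest_common :: "nat \<Rightarrow> (nat \<Rightarrow> 'b) \<Rightarrow> (nat \<Rightarrow> 'b) \<Rightarrow> nat" where
  "longest_common n u v =
     Max {k. \<exists>i j. i + k \<le> n \<and> j + k \<le> n \<and> (\<forall>l<k. u (i + l) = v (j + l))}"

definition longest_common_rle :: "nat \<Rightarrow> (nat \<Rightarrow> 'a) \<Rightarrow> (nat \<Rightarrow> 'a) \<Rightarrow> nat" where
  "longest_common_rle n x y = longest_common n (rle x) (rle y)"

text \<open>Lower Renyi entropy of order 2 of a measure on sequences over the alphabet \<open>B\<close>, possibly
  infinite. For a probability measure concentrated on such sequences the inner (possibly infinite)
  sum converges and lies in \<open>(0, 1]\<close>.\<close>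

definition lower_renyi2 :: "'b set \<Rightarrow> (nat \<Rightarrow> 'b) measure \<Rightarrow> ereal" where
  "lower_renyi2 B P =
     liminf (\<lambda>n. ereal (- (1 / real n) * ln (\<Sum>\<^sub>\<infinity>w\<in>strings B n. (string_prob P w)\<^sup>2)))"

end

theory Submission
  imports Defs "HOL-Real_Asymp.Real_Asymp"
begin

text \<open>A common block of \<open>k\<close> runs among the first \<open>n\<close> runs of \<open>x\<close> and \<open>y\<close> starts at positions
  \<open>p\<close> and \<open>q\<close> of \<open>x\<close> and \<open>y\<close> themselves, where the encodings of the shifted sequences agree
  on their first \<open>k\<close> symbols. The encoding of a stationary process need not be stationary, but
  shifting \<open>x\<close> by a fixed \<open>p\<close> preserves \<open>\<mu>\<close>, so for fixed \<open>p\<close> and \<open>q\<close> this agreement has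
  probability \<open>\<Sum>P(\<omega>)\<^sup>2\<close>. Along \<open>n = 2\<^sup>m\<close>, the exponential bound on constant strings shows that
  almost surely the first \<open>n\<close> runs eventually all have length below \<open>K m\<close>, so that only
  \<open>O((n log n)\<^sup>2)\<close> pairs \<open>(p, q)\<close> matter, and a union bound with the Borel--Cantelli lemma
  excludes \<open>k \<ge> a log n\<close> for every \<open>a > 2 / H\<close>.\<close>

section \<open>Longest common substrings\<close>

lemma common_lengths_finite:
  "finite {k. \<exists>i j. i + k \<le> n \<and> j + k \<le> n \<and> (\<forall>l<k. u (i + l) = v (j + l))}"
  for n :: nat
  by (rule finite_subset[OF _ finite_atMost[of n]]) auto

lemma longest_common_mono:
  assumes "n \<le> n'"
  shows "longest_common n u v \<le> longest_common n' u v"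
  unfolding longest_common_def
proof (rule Max_mono)
  show "{k. \<exists>i j. i + k \<le> n \<and> j + k \<le> n \<and> (\<forall>l<k. u (i + l) = v (j + l))}
      \<subseteq> {k. \<exists>i j. i + k \<le> n' \<and> j + k \<le> n' \<and> (\<forall>l<k. u (i + l) = v (j + l))}"
    using assms by (auto intro: order_trans)
  show "{k. \<exists>i j. i + k \<le> n \<and> j + k \<le> n \<and> (\<forall>l<k. u (i + l) = v (j + l))} \<noteq> {}"
    by (auto intro!: exI[of _ 0])
qed (rule common_lengths_finite)

text \<open>The maximum is attained, and a prefix of a common block is again a common block, so
  every smaller length occurs as well.\<close>

lemma longest_common_geE:
  assumes "k \<le> longest_common n u v"
  obtains i j where "i + k \<le> n" "j + k \<le> n" "\<And>l. l < k \<Longrightarrow> u (i + l) = v (j + l)"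
proof -
  let ?A = "{k. \<exists>i j. i + k \<le> n \<and> j + k \<le> n \<and> (\<forall>l<k. u (i + l) = v (j + l))}"
  have "0 \<in> ?A" by auto
  then have "longest_common n u v \<in> ?A"
    unfolding longest_common_def by (intro Max_in common_lengths_finite) blast
  then obtain i j where ij: "i + longest_common n u v \<le> n" "j + longest_common n u v \<le> n"
      "\<forall>l<longest_common n u v. u (i + l) = v (j + l)" by blast
  show thesis
    by (rule that[of i j]) (use ij assms in auto)
qed

section \<open>Run decompositions\<close>

definition run_start :: "(nat \<Rightarrow> 'a) \<Rightarrow> nat \<Rightarrow> nat" where
  "run_start x i = (\<Sum>l<i. snd (rle x l))"

lemma run_start_Suc: "run_start x (Suc i) = run_start x i + snd (rle x i)"
  by (simp add: run_start_def)

lemma eventually_constant_shift: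
  "eventually_constant (\<lambda>n. x (n + p)) \<longleftrightarrow> eventually_constant x"
proof
  assume "eventually_constant (\<lambda>n. x (n + p))"
  then obtain a N where aN: "\<And>n. n \<ge> N \<Longrightarrow> x (n + p) = a"
    unfolding eventually_constant_def by blast
  have "x n = a" if "n \<ge> N + p" for n
    using aN[of "n - p"] that by simp
  then show "eventually_constant x" unfolding eventually_constant_def by blast
next
  assume "eventually_constant x"
  then obtain a N where "\<forall>n\<ge>N. x n = a" by (auto simp: eventually_constant_def)
  then have "\<forall>n\<ge>N. x (n + p) = a" by simp
  then show "eventually_constant (\<lambda>n. x (n + p))" unfolding eventually_constant_def by blast
qed

text \<open>Runs are nonempty, so run \<open>i\<close> starts at position \<open>i\<close> or later.
  A tail that is constant from \<open>N\<close> on would therefore give runs \<open>N\<close> and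
  \<open>Suc N\<close> the same symbol, against maximality. Hence \<open>x\<close> is not eventually
  constant and uniqueness of the decomposition applies.\<close>

lemma rle_eqI:
  assumes "is_run_decomposition x r"
  shows "rle x = r"
proof -
  have "\<not> eventually_constant x"
  proof
    assume "eventually_constant x"
    then obtain a N where aN: "\<forall>n\<ge>N. x n = a" by (auto simp: eventually_constant_def)
    have ge: "i \<le> (\<Sum>l<i. snd (r l))" for i
    proof (induction i)
      case (Suc i)
      then show ?case using run_length_pos[OF assms, of i] by simp
    qed simp
    have "fst (r i) = a" if "i \<ge> N" for i
      using run_symbol[OF assms run_length_pos[OF assms, of i]] aN ge[of i] that by simp
    then have "fst (r (Suc N)) = fst (r N)" by simp
    then show False using assms by (simp add: is_run_decomposition_def)
  qed
  from run_decomposition_unique[OF rle_is_run_decomposition[OF this] assms] show ?thesis .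
qed

text \<open>Cutting at the start of a run leaves the later runs intact. This trades a shift of the
  encoding, whose law need not be stationary, for a shift of \<open>x\<close> itself.\<close>

lemma rle_shift_run_start:
  assumes "\<not> eventually_constant x"
  shows "rle (\<lambda>n. x (n + run_start x i)) = (\<lambda>l. rle x (i + l))"
proof (rule rle_eqI)
  note d = rle_is_run_decomposition[OF assms]
  have s: "run_start x (i + j) = run_start x i + (\<Sum>l<j. snd (rle x (i + l)))" for j
    by (induction j) (simp_all add: run_start_Suc)
  have "x ((\<Sum>l<k. snd (rle x (i + l))) + j + run_start x i) = fst (rle x (i + k))"
    if "j < snd (rle x (i + k))" for k j
    using run_symbol[OF d that] s[of k] by (simp add: run_start_def ac_simps)
  then show "is_run_decomposition (\<lambda>n. x (n + run_start x i)) (\<lambda>l. rle x (i + l))"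
    using d by (auto simp: is_run_decomposition_def)
qed

text \<open>By induction run \<open>i\<close> starts within the range where
  \<open>no_long_run\<close> applies; as it is constant, it must be shorter than \<open>L\<close>,
  and so each run adds at most \<open>L\<close> to the position.\<close>

lemma run_start_le:
  assumes "\<not> eventually_constant x"
    and no_long_run: "\<And>p a. p \<le> N * L \<Longrightarrow> \<exists>j<L. x (p + j) \<noteq> a"
    and "i \<le> N"
  shows "run_start x i \<le> i * L"
  using \<open>i \<le> N\<close>
proof (induction i)
  case (Suc i)
  then have le: "run_start x i \<le> i * L" by simp
  also have "\<dots> \<le> N * L" using Suc.prems by simp
  finally obtain j where j: "j < L" "x (run_start x i + j) \<noteq> fst (rle x i)"
    using no_long_run by blast
  have "\<not> j < snd (rle x i)"
    using run_symbol[OF rle_is_run_decomposition[OF assms(1)], of j i] j(2)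
    by (auto simp: run_start_def)
  then show ?case using le j(1) by (simp add: run_start_Suc)
qed (simp add: run_start_def)

text \<open>The deterministic core: a common block of encodings is converted into agreement of
  initial segments after shifts \<open>p\<close> and \<open>q\<close>, with few enough candidates
  for a union bound.\<close>

lemma common_run_block:
  assumes x: "\<not> eventually_constant x" "\<And>p a. p \<le> N * L \<Longrightarrow> \<exists>j<L. x (p + j) \<noteq> a"
    and y: "\<not> eventually_constant y" "\<And>p a. p \<le> N * L \<Longrightarrow> \<exists>j<L. y (p + j) \<noteq> a"
    and k: "k \<le> longest_common_rle N x y"
  shows "\<exists>p\<le>N * L. \<exists>q\<le>N * L. \<forall>l<k. rle (\<lambda>n. x (n + p)) l = rle (\<lambda>n. y (n + q)) l"
proof -
  obtain i j where ij: "i + k \<le> N" "j + k \<le> N" "\<And>l. l < k \<Longrightarrow> rle x (i + l) = rle y (j + l)"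
    using longest_common_geE k unfolding longest_common_rle_def by metis
  have "run_start x i \<le> i * L" "run_start y j \<le> j * L"
    using run_start_le[OF x] run_start_le[OF y] ij(1,2) by auto
  moreover have "i * L \<le> N * L" "j * L \<le> N * L" using ij(1,2) by auto
  moreover have "\<forall>l<k. rle (\<lambda>n. x (n + run_start x i)) l = rle (\<lambda>n. y (n + run_start y j)) l"
    using ij(3) by (simp add: rle_shift_run_start x(1) y(1))
  ultimately show ?thesis by (meson order_trans)
qed

section \<open>Measurability of the encoder\<close>

lemma space_seq_space [simp]: "space seq_space = UNIV"
  by (simp add: space_PiM)

lemma measurable_shift: "(\<lambda>x n. x (n + p)) \<in> seq_space \<rightarrow>\<^sub>M seq_space"
  by (rule measurable_abs_UNIV) simp

lemma pred_eventually_constant [measurable]: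
  "Measurable.pred (seq_space :: (nat \<Rightarrow> 'a::countable) measure) eventually_constant"
  unfolding eventually_constant_def[abs_def] by measurable

text \<open>The definite description in \<open>rle\<close> does not reveal measurability. Least
  witnesses, iterated in \<open>change_points\<close>, give an explicit formula for the run starts
  from which it can be derived.\<close>

definition next_change :: "(nat \<Rightarrow> 'a) \<Rightarrow> nat \<Rightarrow> nat" where
  "next_change x m = (LEAST k. m < k \<and> x k \<noteq> x m)"

primrec change_points :: "nat \<Rightarrow> (nat \<Rightarrow> 'a) \<Rightarrow> nat" where
  "change_points 0 x = 0"
| "change_points (Suc i) x = next_change x (change_points i x)"

text \<open>Inside a run the symbol does not change, and by maximality the next run opens with a
  different one, so the first change is exactly the next run start.\<close>

lemma run_start_eq_change_points:
  assumes "\<not> eventually_constant x"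
  shows "run_start x i = change_points i x"
proof (induction i)
  case (Suc i)
  note d = rle_is_run_decomposition[OF assms]
  have sym: "x (run_start x i + j) = fst (rle x i)" if "j < snd (rle x i)" for i j
    using run_symbol[OF d that] by (simp add: run_start_def)
  have s0: "x (run_start x i) = fst (rle x i)" for i
    using sym[of 0] run_length_pos[OF d] by simp
  have "next_change x (run_start x i) = run_start x (Suc i)"
    unfolding next_change_def
  proof (rule Least_equality)
    show "run_start x i < run_start x (Suc i) \<and> x (run_start x (Suc i)) \<noteq> x (run_start x i)"
      using d run_length_pos[OF d] by (simp add: s0 is_run_decomposition_def) (simp add: run_start_Suc)
  next
    fix k assume k: "run_start x i < k \<and> x k \<noteq> x (run_start x i)"
    show "run_start x (Suc i) \<le> k"
    proof (rule ccontr)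
      assume "\<not> run_start x (Suc i) \<le> k"
      then have "k - run_start x i < snd (rle x i)" using k by (auto simp: run_start_Suc)
      then show False using sym[of "k - run_start x i" i] k s0[of i] by simp
    qed
  qed
  then show ?case using Suc by simp
qed (simp add: run_start_def)

lemma rle_eq_change_points:
  assumes "\<not> eventually_constant x"
  shows "rle x i = (x (change_points i x), change_points (Suc i) x - change_points i x)"
proof -
  note d = rle_is_run_decomposition[OF assms]
  have "snd (rle x i) = run_start x (Suc i) - run_start x i" by (simp add: run_start_Suc)
  moreover have "fst (rle x i) = x (run_start x i)"
    using run_symbol[OF d run_length_pos[OF d, of i]] by (simp add: run_start_def)
  ultimately show ?thesis
    unfolding run_start_eq_change_points[OF assms] by (metis prod.collapse)
qed

text \<open>For fixed \<open>m\<close>, \<open>next_change x m\<close> is a least witness of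
  measurable predicates. The previous change point takes countably many values, so substituting it
  for \<open>m\<close> preserves measurability.\<close>

lemma measurable_change_points [measurable]:
  "change_points i \<in> (seq_space :: (nat \<Rightarrow> 'a::countable) measure) \<rightarrow>\<^sub>M count_space UNIV"
proof (induction i)
  case (Suc i)
  have [measurable]:
    "(\<lambda>x. next_change x m) \<in> (seq_space :: (nat \<Rightarrow> 'a) measure) \<rightarrow>\<^sub>M count_space UNIV" for m
    unfolding next_change_def by measurable
  show ?case
    using measurable_compose_countable[OF _ Suc, of "\<lambda>m x. next_change x m"] by simp
qed simp

lemma measurable_rle [measurable]:
  "rle \<in> (seq_space :: (nat \<Rightarrow> 'a::countable) measure) \<rightarrow>\<^sub>M seq_space"
proof -
  have [measurable]: "(\<lambda>x. x (change_points i x)) \<in> (seq_space :: (nat \<Rightarrow> 'a) measure) \<rightarrow>\<^sub>M count_space UNIV" for i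
    by (rule measurable_compose_countable[OF _ measurable_change_points, of "\<lambda>m x. x m"]) simp
  \<comment> \<open>The first branch reproduces the default value of \<open>rle\<close>, so that the
    equality below holds on the whole space and not just almost everywhere.\<close>
  have "(\<lambda>x i. if eventually_constant x then (undefined, 0)
            else (x (change_points i x), change_points (Suc i) x - change_points i x))
        \<in> (seq_space :: (nat \<Rightarrow> 'a) measure) \<rightarrow>\<^sub>M seq_space"
    by (rule measurable_abs_UNIV) measurable
  also have "(\<lambda>x i. if eventually_constant x then (undefined, 0)
            else (x (change_points i x), change_points (Suc i) x - change_points i x)) = rle"
    by (intro ext) (auto simp: rle_eq_change_points[simplified], simp add: rle_def)
  finally show ?thesis .
qed

section \<open>Collision probabilities\<close>

text \<open>Membership in \<open>B\<close> discards the default value of \<open>rle\<close> on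
  eventually constant sequences, so that the event matches a sum over \<open>strings B k\<close>
  exactly.\<close>

definition collision :: "'b set \<Rightarrow> nat \<Rightarrow> (nat \<Rightarrow> 'b) \<Rightarrow> (nat \<Rightarrow> 'b) \<Rightarrow> bool" where
  "collision B k u v \<longleftrightarrow> (\<forall>l<k. u l \<in> B \<and> u l = v l)"

text \<open>The event is a countable disjoint union, over words \<open>w\<close> of length
  \<open>k\<close>, of products of two cylinders. Each product has measure
  \<open>string_prob P w\<close> squared. \<open>U\<close> and \<open>V\<close> are kept separate
  because they will be encodings after different shifts, with the same law.\<close>

lemma measure_collision:
  fixes U V :: "'w \<Rightarrow> nat \<Rightarrow> 'b::countable"
  assumes "prob_space M"
    and U[measurable]: "U \<in> M \<rightarrow>\<^sub>M seq_space" and V[measurable]: "V \<in> M \<rightarrow>\<^sub>M seq_space"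
    and dU: "distr M seq_space U = P" and dV: "distr M seq_space V = P"
  shows "{z \<in> space (M \<Otimes>\<^sub>M M). collision B k (U (fst z)) (V (snd z))} \<in> sets (M \<Otimes>\<^sub>M M)"
    and "measure (M \<Otimes>\<^sub>M M) {z \<in> space (M \<Otimes>\<^sub>M M). collision B k (U (fst z)) (V (snd z))}
           = (\<Sum>\<^sub>\<infinity>w\<in>strings B k. (string_prob P w)\<^sup>2)"
proof -
  interpret prob_space M by fact
  interpret MM: pair_prob_space M M ..
  let ?E = "{z \<in> space (M \<Otimes>\<^sub>M M). collision B k (U (fst z)) (V (snd z))}"
  let ?p = "string_prob P"
  define A where "A f w = {x \<in> space M. \<forall>i<length w. f x i = w ! i}" for f :: "'w \<Rightarrow> nat \<Rightarrow> 'b" and w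
  have cyl: "{z :: nat \<Rightarrow> 'b. \<forall>i<length w. z i = w ! i} \<in> sets seq_space" for w
  proof -
    have "{z \<in> space seq_space. \<forall>i<length w. z i = w ! i} \<in> sets (seq_space :: (nat \<Rightarrow> 'b) measure)"
      by measurable
    then show ?thesis by simp
  qed
  have A_eq: "A f w = f -` {z. \<forall>i<length w. z i = w ! i} \<inter> space M" for f w
    by (auto simp: A_def)
  have sets_A: "A f w \<in> sets M" if "f \<in> M \<rightarrow>\<^sub>M seq_space" for f w
    unfolding A_eq using that cyl by (rule measurable_sets)
  have p: "?p w = measure M (A f w)"
    if "f \<in> M \<rightarrow>\<^sub>M seq_space" "distr M seq_space f = P" for f w
  proof -
    have "space P = UNIV" using that(2) by auto
    then show ?thesis
      unfolding string_prob_def A_eq using measure_distr[OF that(1) cyl, of w] that(2) by simp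
  qed
  have E: "?E = (\<Union>w\<in>strings B k. A U w \<times> A V w)"
  proof (intro set_eqI iffI)
    fix z assume "z \<in> ?E"
    then have z: "fst z \<in> space M" "snd z \<in> space M" "\<forall>l<k. U (fst z) l \<in> B \<and> U (fst z) l = V (snd z) l"
      by (auto simp: space_pair_measure collision_def)
    have "map (U (fst z)) [0..<k] \<in> strings B k" using z(3) by (auto simp: strings_def)
    moreover have "z \<in> A U (map (U (fst z)) [0..<k]) \<times> A V (map (U (fst z)) [0..<k])"
      using z by (auto simp: A_def mem_Times_iff)
    ultimately show "z \<in> (\<Union>w\<in>strings B k. A U w \<times> A V w)" by blast
  qed (auto simp: A_def strings_def collision_def space_pair_measure)
  have sets_AA: "A U w \<times> A V w \<in> sets (M \<Otimes>\<^sub>M M)" for w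
    using sets_A U V by auto
  show sets_E: "?E \<in> sets (M \<Otimes>\<^sub>M M)"
    unfolding E using sets_AA by (intro sets.countable_UN') auto
  have disj: "disjoint_family_on (\<lambda>w. A U w \<times> A V w) (strings B k)"
    by (auto simp: disjoint_family_on_def A_def strings_def intro: nth_equalityI)
  have "emeasure (M \<Otimes>\<^sub>M M) ?E = (\<integral>\<^sup>+w. emeasure (M \<Otimes>\<^sub>M M) (A U w \<times> A V w) \<partial>count_space (strings B k))"
    unfolding E by (rule emeasure_UN_countable) (use sets_AA disj in auto)
  also have "\<dots> = (\<integral>\<^sup>+w. ennreal ((?p w)\<^sup>2) \<partial>count_space (strings B k))"
    by (intro nn_integral_cong)
      (simp add: emeasure_pair_measure_Times sets_A U V emeasure_eq_measure
        p[OF U dU, symmetric] p[OF V dV, symmetric] string_prob_def power2_eq_square ennreal_mult)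
  finally have em: "ennreal (measure (M \<Otimes>\<^sub>M M) ?E) = (\<integral>\<^sup>+w. ennreal ((?p w)\<^sup>2) \<partial>count_space (strings B k))"
    by (simp add: MM.emeasure_eq_measure)
  \<comment> \<open>The integral equals the probability of an event and is thus finite; this is what
    lets it be read as a real infinite sum.\<close>
  have int: "integrable (count_space (strings B k)) (\<lambda>w. (?p w)\<^sup>2)"
    by (rule integrableI_nn_integral_finite[OF _ _ em[symmetric]]) auto
  have "(\<integral>\<^sup>+w. ennreal ((?p w)\<^sup>2) \<partial>count_space (strings B k)) = ennreal (\<Sum>\<^sub>\<infinity>w\<in>strings B k. (?p w)\<^sup>2)"
    using int by (simp add: nn_integral_eq_integral infsetsum_infsum[symmetric] infsetsum_def
        Infinite_Set_Sum.abs_summable_on_def)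
  then show "measure (M \<Otimes>\<^sub>M M) ?E = (\<Sum>\<^sub>\<infinity>w\<in>strings B k. (?p w)\<^sup>2)"
    using em by (simp add: infsum_nonneg)
qed

text \<open>Exponential decay beats the polynomial even after multiplication by
  \<open>m ^ 2\<close>, so the terms are eventually below the inverse squares. Both Borel-Cantelli
  arguments rest on this.\<close>

lemma summable_linear_square_times_exp:
  fixes b d :: real
  assumes "b > 0" "d > 0"
  shows "summable (\<lambda>m. (b * real m + 1)\<^sup>2 * exp (- (d * real m)))"
proof -
  have "(\<lambda>m. (b * real m + 1)\<^sup>2 * exp (- (d * real m)) * real m ^ 2) \<longlonglongrightarrow> 0"
    using assms by real_asymp
  then have "\<forall>\<^sub>F m in sequentially. (b * real m + 1)\<^sup>2 * exp (- (d * real m)) * real m ^ 2 < 1"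
    by (rule order_tendstoD) simp
  then have "\<forall>\<^sub>F m in sequentially.
      norm ((b * real m + 1)\<^sup>2 * exp (- (d * real m))) \<le> inverse (real m ^ 2)"
    using eventually_gt_at_top[of 0] by eventually_elim (simp add: field_simps)
  then show ?thesis
    by (rule summable_comparison_test_ev) (rule inverse_power_summable, simp)
qed

section \<open>Shift-invariant laws\<close>

lemma AE_pair_fst:
  assumes "prob_space M" "prob_space N" "AE x in M. Q x"
  shows "AE z in M \<Otimes>\<^sub>M N. Q (fst z)"
proof -
  have "distr (M \<Otimes>\<^sub>M N) M fst = M"
    using prob_space.distr_pair_fst[OF assms(2)] .
  then have "AE x in distr (M \<Otimes>\<^sub>M N) M fst. Q x" using assms(3) by metis
  then show ?thesis by (rule AE_distrD[OF measurable_fst])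
qed

text \<open>Swapping the factors reduces the claim to the first marginal.\<close>

lemma AE_pair_snd:
  assumes "prob_space M" "prob_space N" "AE y in N. Q y"
  shows "AE z in M \<Otimes>\<^sub>M N. Q (snd z)"
proof -
  interpret M: prob_space M by fact
  interpret N: prob_space N by fact
  interpret pair_prob_space N M ..
  have "distr (M \<Otimes>\<^sub>M N) N snd
      = distr (distr (M \<Otimes>\<^sub>M N) (N \<Otimes>\<^sub>M M) (\<lambda>(x, y). (y, x))) N fst"
    by (simp add: distr_distr comp_def case_prod_beta)
  also have "\<dots> = N" unfolding distr_pair_swap[symmetric] by (rule M.distr_pair_fst)
  finally have "AE y in distr (M \<Otimes>\<^sub>M N) N snd. Q y" using assms(3) by metis
  then show ?thesis by (rule AE_distrD[OF measurable_snd])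
qed

locale shift_invariant = prob_space \<mu> for \<mu> :: "(nat \<Rightarrow> 'a::finite) measure" +
  assumes sets_law [measurable_cong]: "sets \<mu> = sets seq_space"
    and shift: "\<And>p. distr \<mu> seq_space (\<lambda>x n. x (n + p)) = \<mu>"
begin

lemma space_law [simp]: "space \<mu> = UNIV"
  using sets_eq_imp_space_eq[OF sets_law] by simp

lemma measurable_shift_law: "(\<lambda>x n. x (n + p)) \<in> \<mu> \<rightarrow>\<^sub>M seq_space"
  using measurable_shift measurable_cong_sets[OF sets_law refl] by blast

lemma constant_block_sets [measurable]: "{x. \<forall>j<L. x (p + j) = a} \<in> sets \<mu>"
proof -
  have "{x \<in> space \<mu>. \<forall>j<L. x (p + j) = a} \<in> sets \<mu>" by measurable
  then show ?thesis by simp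
qed

text \<open>Shift invariance moves the block to the origin, where the exponential bound is
  stated.\<close>

lemma measure_constant_block:
  "measure \<mu> {x. \<forall>j<L. x (p + j) = a} = string_prob \<mu> (replicate L a)"
proof -
  let ?A = "{x :: nat \<Rightarrow> 'a. \<forall>j<L. x j = a}"
  have "?A \<in> sets \<mu>" using constant_block_sets[of L 0 a] by simp
  then have "measure (distr \<mu> seq_space (\<lambda>x n. x (n + p))) ?A = measure \<mu> {x. \<forall>j<L. x (p + j) = a}"
    by (subst measure_distr) (auto simp: sets_law measurable_shift_law vimage_def add.commute)
  moreover have "string_prob \<mu> (replicate L a) = measure \<mu> ?A"
    unfolding string_prob_def by (rule arg_cong[where f = "measure \<mu>"]) auto
  ultimately show ?thesis by (simp add: shift)
qed

text \<open>This is where stationarity enters for the encoder: shifting before encoding, by a fixed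
  \<open>p\<close>, does not change the law of the encoding.\<close>

lemma distr_rle_shift:
  "distr \<mu> seq_space (\<lambda>x. rle (\<lambda>n. x (n + p))) = rle_pushforward \<mu>"
proof -
  have "distr (distr \<mu> seq_space (\<lambda>x n. x (n + p))) seq_space rle
      = distr \<mu> seq_space (\<lambda>x. rle (\<lambda>n. x (n + p)))"
    by (subst distr_distr) (simp_all add: comp_def measurable_shift_law)
  then show ?thesis by (simp add: shift rle_pushforward_def)
qed

end

section \<open>Laws with exponentially rare constant blocks\<close>

locale exp_bounded_law = shift_invariant \<mu> for \<mu> :: "(nat \<Rightarrow> 'a::finite) measure" +
  fixes c h :: real
  assumes c_pos: "c > 0" and h_pos: "h > 0"
    and exp_bound: "\<And>n a. n \<ge> 1 \<Longrightarrow> string_prob \<mu> (replicate n a) \<le> c * exp (- h * real n)"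
begin

text \<open>A tail equal to \<open>a\<close> from \<open>N\<close> on contains constant blocks of
  every length, so its probability is below every \<open>c * exp (- h * real n)\<close>. Only
  countably many pairs of \<open>N\<close> and \<open>a\<close> occur.\<close>

lemma AE_not_eventually_constant: "AE x in \<mu>. \<not> eventually_constant x"
proof -
  have "{x. \<forall>n\<ge>N. x n = a} \<in> null_sets \<mu>" for N a
  proof -
    let ?A = "{x :: nat \<Rightarrow> 'a. \<forall>n\<ge>N. x n = a}"
    have "{x \<in> space \<mu>. \<forall>n\<ge>N. x n = a} \<in> sets \<mu>" by measurable
    then have sets: "?A \<in> sets \<mu>" by simp
    have "measure \<mu> ?A \<le> c * exp (- h * real n)" if "n \<ge> 1" for n
    proof -
      have "measure \<mu> ?A \<le> measure \<mu> {x. \<forall>j<n. x (N + j) = a}"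
        by (rule finite_measure_mono) auto
      then show ?thesis using exp_bound[OF that, of a] by (simp add: measure_constant_block)
    qed
    then have "\<forall>\<^sub>F n in sequentially. measure \<mu> ?A \<le> c * exp (- h * real n)"
      by (auto simp: eventually_sequentially)
    moreover have lim: "(\<lambda>n. c * exp (- h * real n)) \<longlonglongrightarrow> 0"
      using h_pos c_pos by real_asymp
    ultimately have "measure \<mu> ?A \<le> 0"
      by (intro tendsto_lowerbound[OF lim]) simp_all
    then have "measure \<mu> ?A = 0" using measure_nonneg[of \<mu> ?A] by linarith
    then show ?thesis using sets by (simp add: null_sets_def emeasure_eq_measure)
  qed
  then have "AE x in \<mu>. \<forall>N a. x \<notin> {x. \<forall>n\<ge>N. x n = a}"
    unfolding AE_all_countable by (intro allI AE_not_in)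
  then show ?thesis by eventually_elim (auto simp: eventually_constant_def)
qed

text \<open>Union bound over the \<open>N + 1\<close> starting positions and all letters.\<close>

lemma measure_long_run:
  assumes "L \<ge> 1"
  shows "{x. \<exists>p\<le>N. \<exists>a. \<forall>j<L. x (p + j) = a} \<in> sets \<mu>"
    and "measure \<mu> {x. \<exists>p\<le>N. \<exists>a. \<forall>j<L. x (p + j) = a}
           \<le> (real N + 1) * (real CARD('a) * (c * exp (- h * real L)))"
proof -
  let ?E = "{x :: nat \<Rightarrow> 'a. \<exists>p\<le>N. \<exists>a. \<forall>j<L. x (p + j) = a}"
  have E: "?E = (\<Union>(p, a)\<in>{..N} \<times> UNIV. {x. \<forall>j<L. x (p + j) = a})" by auto
  show "?E \<in> sets \<mu>" unfolding E by (intro sets.finite_UN) (auto simp: constant_block_sets)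
  have "measure \<mu> ?E \<le> (\<Sum>(p, a)\<in>{..N} \<times> UNIV. measure \<mu> {x. \<forall>j<L. x (p + j) = a})"
    unfolding E case_prod_beta by (rule measure_UNION_le) (auto simp: constant_block_sets)
  also have "\<dots> \<le> (\<Sum>(p, a)\<in>{..N} \<times> (UNIV :: 'a set). c * exp (- h * real L))"
    by (rule sum_mono) (use exp_bound[OF assms] in \<open>auto simp: measure_constant_block\<close>)
  also have "\<dots> = (real N + 1) * (real CARD('a) * (c * exp (- h * real L)))"
    by (simp add: case_prod_beta card_cartesian_product algebra_simps)
  finally show "measure \<mu> ?E \<le> (real N + 1) * (real CARD('a) * (c * exp (- h * real L)))" .
qed

text \<open>The constant \<open>1 / 4\<close> makes a block of length \<open>K * m\<close> cost
  \<open>4 ^ m\<close>, against about \<open>2 ^ m * (K * m)\<close> positions. What remains is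
  \<open>2 ^ m\<close> in the denominator against a linear factor, which is summable, and
  Borel-Cantelli applies.\<close>

lemma AE_no_long_runs:
  assumes "exp (- h * real K) \<le> 1 / 4" "K \<ge> 1"
  shows "AE x in \<mu>. \<forall>\<^sub>F m in sequentially. \<forall>p\<le>2 ^ m * (K * m). \<forall>a. \<exists>j<K * m. x (p + j) \<noteq> a"
proof -
  define E where
    "E m = {x :: nat \<Rightarrow> 'a. \<exists>p\<le>2 ^ m * (K * m). \<exists>a. \<forall>j<K * m. x (p + j) = a}" for m
  \<comment> \<open>For \<open>m = 0\<close> the block is empty and \<open>E 0\<close> is the whole
    space, so the estimates start at \<open>Suc m\<close>.\<close>
  have L: "K * Suc m \<ge> 1" for m using assms(2) by simp
  have sets: "E (Suc m) \<in> sets \<mu>" for m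
    unfolding E_def using measure_long_run(1)[OF L] .
  have bound: "measure \<mu> (E (Suc m))
      \<le> (real K * real (Suc m) + 1)\<^sup>2 * exp (- (ln 2 * real (Suc m))) * (real CARD('a) * c)" for m
  proof -
    define M where "M = Suc m"
    have "measure \<mu> (E M) \<le> (real (2 ^ M * (K * M)) + 1) * (real CARD('a) * (c * exp (- h * real (K * M))))"
      unfolding E_def M_def by (rule measure_long_run(2)[OF L])
    also have "exp (- h * real (K * M)) = exp (- h * real K) ^ M"
      by (simp add: exp_of_nat_mult[symmetric] algebra_simps)
    also have "\<dots> \<le> (1 / 4) ^ M"
      using assms(1) by (intro power_mono) auto
    also have "real (2 ^ M * (K * M)) + 1 \<le> 2 ^ M * (real K * real M + 1)"
      by (simp add: algebra_simps)
    also have "2 ^ M * (real K * real M + 1) * (real CARD('a) * (c * (1 / 4) ^ M))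
        = (real K * real M + 1) * ((2 * (1 / 4)) ^ M) * (real CARD('a) * c)"
      unfolding power_mult_distrib by simp
    also have "(2 * (1 / 4) :: real) ^ M = exp (- (ln 2 * real M))"
    proof -
      have "exp (- (ln 2 * real M)) = exp (- ln 2) ^ M"
        by (simp flip: exp_of_nat_mult add: mult.commute)
      then show ?thesis by (simp add: exp_minus power_one_over power_inverse)
    qed
    \<comment> \<open>Squaring only brings the term into the form of the summability lemma.\<close>
    also have "real K * real M + 1 \<le> (real K * real M + 1)\<^sup>2"
      by (rule self_le_power) simp_all
    finally show ?thesis using c_pos by (simp add: M_def mult_left_mono)
  qed
  have "summable (\<lambda>m. (real K * real (Suc m) + 1)\<^sup>2 * exp (- (ln 2 * real (Suc m))) * (real CARD('a) * c))"
    using summable_linear_square_times_exp[of "real K" "ln 2"] assms(2)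
    by (intro summable_mult2) (simp only: summable_Suc_iff[where f = "\<lambda>m. (real K * real m + 1)\<^sup>2 * exp (- (ln 2 * real m))"], simp)
  then have "summable (\<lambda>m. measure \<mu> (E (Suc m)))"
    by (rule summable_comparison_test'[of _ 0]) (use bound in auto)
  then have "AE x in \<mu>. \<forall>\<^sub>F m in sequentially. x \<in> space \<mu> - E (Suc m)"
    by (intro borel_cantelli_AE1 sets) (simp_all add: emeasure_eq_measure)
  then show ?thesis
  proof eventually_elim
    case (elim x)
    then have "\<forall>\<^sub>F m in sequentially. x \<notin> E (Suc m)" by simp
    then have "\<forall>\<^sub>F m in sequentially. x \<notin> E m" by (rule eventually_sequentially_Suc[THEN iffD1])
    then show ?case by eventually_elim (auto simp: E_def)
  qed
qed

section \<open>Collisions of encodings after shifts\<close>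

abbreviation collision_prob :: "nat \<Rightarrow> real" where
  "collision_prob k \<equiv> \<Sum>\<^sub>\<infinity>w\<in>strings run_alphabet k. (string_prob (rle_pushforward \<mu>) w)\<^sup>2"

text \<open>Union bound over the pairs of shifts; by \<open>distr_rle_shift\<close> every pair
  contributes the same \<open>collision_prob k\<close>.\<close>

lemma measure_shifted_collision:
  defines "E \<equiv> (\<lambda>N k. {z \<in> space (\<mu> \<Otimes>\<^sub>M \<mu>). \<exists>p\<le>N. \<exists>q\<le>N.
      collision run_alphabet k (rle (\<lambda>n. fst z (n + p))) (rle (\<lambda>n. snd z (n + q)))})"
  shows "E N k \<in> sets (\<mu> \<Otimes>\<^sub>M \<mu>)"
    and "measure (\<mu> \<Otimes>\<^sub>M \<mu>) (E N k) \<le> (real N + 1)\<^sup>2 * collision_prob k"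
proof -
  define F where "F p q = {z \<in> space (\<mu> \<Otimes>\<^sub>M \<mu>).
      collision run_alphabet k (rle (\<lambda>n. fst z (n + p))) (rle (\<lambda>n. snd z (n + q)))}" for p q
  have m: "(\<lambda>x. rle (\<lambda>n. x (n + p))) \<in> \<mu> \<rightarrow>\<^sub>M seq_space" for p
    by (rule measurable_compose[OF measurable_shift_law measurable_rle])
  note F = measure_collision[OF prob_space_axioms m m distr_rle_shift distr_rle_shift,
      where B = run_alphabet and k = k, folded F_def]
  have E: "E N k = (\<Union>(p, q)\<in>{..N} \<times> {..N}. F p q)"
    by (auto simp: E_def F_def)
  show "E N k \<in> sets (\<mu> \<Otimes>\<^sub>M \<mu>)" unfolding E by (intro sets.finite_UN) (auto simp: F(1))
  have "measure (\<mu> \<Otimes>\<^sub>M \<mu>) (E N k) \<le> (\<Sum>(p, q)\<in>{..N} \<times> {..N}. measure (\<mu> \<Otimes>\<^sub>M \<mu>) (F p q))"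
    unfolding E case_prod_beta by (rule measure_UNION_le) (auto simp: F(1))
  also have "\<dots> = (real N + 1)\<^sup>2 * collision_prob k"
    by (simp add: F(2) case_prod_beta card_cartesian_product power2_eq_square algebra_simps)
  finally show "measure (\<mu> \<Otimes>\<^sub>M \<mu>) (E N k) \<le> (real N + 1)\<^sup>2 * collision_prob k" .
qed

text \<open>There are about \<open>(2 ^ m * (K * m))\<close> squared pairs of shifts, each colliding
  with probability at most \<open>exp (- t * a * m * ln 2)\<close>. Up to polynomial factors the
  product is \<open>2\<close> to the power \<open>- (a * t - 2) * m\<close>, which is where
  \<open>a * t > 2\<close> is used.\<close>

lemma AE_longest_common_rle_less:
  fixes a t :: real
  assumes "t > 0" "a * t > 2"
    and collision: "\<forall>\<^sub>F k in sequentially. collision_prob k \<le> exp (- t * real k)"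
  shows "AE z in \<mu> \<Otimes>\<^sub>M \<mu>. \<forall>\<^sub>F m in sequentially.
           longest_common_rle (2 ^ m) (fst z) (snd z) < nat \<lceil>a * real m * ln 2\<rceil>"
proof -
  interpret MM: pair_prob_space \<mu> \<mu> ..
  have a: "a > 0" using assms(1,2) mult_nonpos_nonneg[of a t] by (cases "a > 0") auto
  have "(\<lambda>n. exp (- h * real n)) \<longlonglongrightarrow> 0" using h_pos by real_asymp
  then have "\<forall>\<^sub>F n in sequentially. exp (- h * real n) < 1 / 4" by (rule order_tendstoD) simp
  then obtain K where K: "exp (- h * real K) \<le> 1 / 4" "K \<ge> 1"
    using eventually_happens'[OF _ eventually_conj[OF _ eventually_ge_at_top[of 1]]]
    by (metis less_imp_le sequentially_bot)
  define k where "k m = nat \<lceil>a * real m * ln 2\<rceil>" for m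
  define N where "N m = 2 ^ m * (K * m)" for m
  have k_ge: "real (k m) \<ge> a * real m * ln 2" for m
    unfolding k_def by linarith
  define E where "E m = {z \<in> space (\<mu> \<Otimes>\<^sub>M \<mu>). \<exists>p\<le>N m. \<exists>q\<le>N m.
      collision run_alphabet (k m) (rle (\<lambda>n. fst z (n + p))) (rle (\<lambda>n. snd z (n + q)))}" for m
  note E = measure_shifted_collision[where N = "N m" and k = "k m" for m, folded E_def]
  \<comment> \<open>The collision bound holds only for large lengths, so \<open>k m\<close> has to
    tend to infinity.\<close>
  have "filterlim (\<lambda>m. a * real m * ln 2) at_top sequentially" using a by real_asymp
  then have "filterlim (\<lambda>m. real (k m)) at_top sequentially"
    by (rule filterlim_at_top_mono) (simp add: k_ge)
  then have "filterlim k at_top sequentially"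
    by (simp add: filterlim_real_sequentially filterlim_sequentially_iff_filterlim_real)
  from eventually_compose_filterlim[OF collision this]
  have ev: "\<forall>\<^sub>F m in sequentially. measure (\<mu> \<Otimes>\<^sub>M \<mu>) (E m)
      \<le> (real K * real m + 1)\<^sup>2 * exp (- ((a * t - 2) * ln 2 * real m))"
  proof eventually_elim
    case (elim m)
    have "measure (\<mu> \<Otimes>\<^sub>M \<mu>) (E m) \<le> (real (N m) + 1)\<^sup>2 * collision_prob (k m)"
      by (rule E(2))
    also have "\<dots> \<le> (2 ^ m * (real K * real m + 1))\<^sup>2 * exp (- t * (a * real m * ln 2))"
    proof (rule mult_mono)
      show "(real (N m) + 1)\<^sup>2 \<le> (2 ^ m * (real K * real m + 1))\<^sup>2"
        by (rule power_mono) (simp_all add: N_def algebra_simps)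
      have "- t * real (k m) \<le> - t * (a * real m * ln 2)"
        using k_ge[of m] assms(1) by simp
      then show "collision_prob (k m) \<le> exp (- t * (a * real m * ln 2))"
        using elim by (meson exp_le_cancel_iff order_trans)
    qed (simp_all add: infsum_nonneg)
    also have "(2 ^ m * (real K * real m + 1))\<^sup>2 = (real K * real m + 1)\<^sup>2 * exp (2 * ln 2 * real m)"
    proof -
      have "(2 ^ m :: real) = exp (real m * ln 2)" by (simp add: exp_of_nat_mult)
      then show ?thesis by (simp add: power_mult_distrib exp_double[symmetric] mult_ac)
    qed
    also have "\<dots> * exp (- t * (a * real m * ln 2))
        = (real K * real m + 1)\<^sup>2 * exp (- ((a * t - 2) * ln 2 * real m))"
      by (simp add: mult.assoc exp_add[symmetric] algebra_simps)
    finally show ?case .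
  qed
  have "summable (\<lambda>m. (real K * real m + 1)\<^sup>2 * exp (- ((a * t - 2) * ln 2 * real m)))"
    using assms(2) K(2) by (intro summable_linear_square_times_exp) simp_all
  then have "summable (\<lambda>m. measure (\<mu> \<Otimes>\<^sub>M \<mu>) (E m))"
    by (rule summable_comparison_test_ev[rotated]) (use ev in simp)
  then have "AE z in \<mu> \<Otimes>\<^sub>M \<mu>. \<forall>\<^sub>F m in sequentially. z \<in> space (\<mu> \<Otimes>\<^sub>M \<mu>) - E m"
    by (intro borel_cantelli_AE1 E(1)) (simp_all add: MM.emeasure_eq_measure)
  moreover note AE_pair_fst[OF prob_space_axioms prob_space_axioms AE_no_long_runs[OF K]]
  moreover note AE_pair_snd[OF prob_space_axioms prob_space_axioms AE_no_long_runs[OF K]]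
  moreover note AE_pair_fst[OF prob_space_axioms prob_space_axioms AE_not_eventually_constant]
  moreover note AE_pair_snd[OF prob_space_axioms prob_space_axioms AE_not_eventually_constant]
  ultimately show ?thesis
  proof eventually_elim
    case (elim z)
    from elim(1-3) show ?case
    proof eventually_elim
      case inner: (elim m)
      show ?case
      proof (rule ccontr)
        assume "\<not> ?thesis"
        then have "k m \<le> longest_common_rle (2 ^ m) (fst z) (snd z)" unfolding k_def by linarith
        from common_run_block[OF elim(4) _ elim(5) _ this, of "K * m"] inner(2,3)
        obtain p q where pq: "p \<le> N m" "q \<le> N m"
            "\<forall>l<k m. rle (\<lambda>n. fst z (n + p)) l = rle (\<lambda>n. snd z (n + q)) l"
          unfolding N_def by blast
        \<comment> \<open>Agreement alone is not yet a collision: the common symbols must be genuine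
          runs, which holds because the shifted sequence is not eventually constant.\<close>
        have "rle (\<lambda>n. fst z (n + p)) l \<in> run_alphabet" for l
          using rle_is_run_decomposition[of "\<lambda>n. fst z (n + p)"] elim(4)
          by (simp add: eventually_constant_shift is_run_decomposition_def)
        then have "z \<in> E m"
          using pq inner(1) by (auto simp: E_def collision_def)
        then show False using inner(1) by simp
      qed
    qed
  qed
qed

end

text \<open>The longest common block is monotone in \<open>n\<close>, so \<open>n\<close> may be
  rounded up to a power of two. This changes the bound only by an additive constant, negligible
  against \<open>ln n\<close>.\<close>

lemma limsup_longest_common_rle_le:
  assumes "a > 0"
    and "\<forall>\<^sub>F m in sequentially. longest_common_rle (2 ^ m) x y < nat \<lceil>a * real m * ln 2\<rceil>"
  shows "limsup (\<lambda>n. ereal (real (longest_common_rle n x y) / ln (real n))) \<le> ereal a"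
proof -
  obtain m0 where m0: "\<And>m. m \<ge> m0 \<Longrightarrow> longest_common_rle (2 ^ m) x y < nat \<lceil>a * real m * ln 2\<rceil>"
    using assms(2) by (auto simp: eventually_sequentially)
  have bound: "real (longest_common_rle n x y) / ln (real n)
      \<le> (a * (log 2 (real n) + 1) * ln 2 + 1) / ln (real n)" if n: "n \<ge> 2 ^ m0" "n \<ge> 2" for n
  proof -
    define m where "m = nat \<lceil>log 2 (real n)\<rceil>"
    have log: "log 2 (real n) > 0" using n by simp
    have "real m0 \<le> log 2 (real n)"
      using n by (intro le_log_of_power) (simp_all flip: of_nat_power)
    then have "m \<ge> m0" unfolding m_def by linarith
    have m_le: "real m \<le> log 2 (real n) + 1" and m_ge: "log 2 (real n) \<le> real m"
      using log unfolding m_def by linarith+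
    have "real n \<le> 2 powr real m" using m_ge n by (subst (asm) log_le_iff) auto
    then have "real n \<le> real (2 ^ m)" by (simp add: powr_realpow)
    then have "n \<le> 2 ^ m" by (simp only: of_nat_le_iff)
    then have "longest_common_rle n x y \<le> longest_common_rle (2 ^ m) x y"
      unfolding longest_common_rle_def by (rule longest_common_mono)
    also have "\<dots> < nat \<lceil>a * real m * ln 2\<rceil>" using m0[OF \<open>m \<ge> m0\<close>] .
    finally have "real (longest_common_rle n x y) \<le> a * real m * ln 2 + 1" by linarith
    also have "\<dots> \<le> a * (log 2 (real n) + 1) * ln 2 + 1"
      using m_le assms(1) by simp
    finally show ?thesis using n by (intro divide_right_mono) auto
  qed
  have "limsup (\<lambda>n. ereal (real (longest_common_rle n x y) / ln (real n)))
      \<le> limsup (\<lambda>n. ereal ((a * (log 2 (real n) + 1) * ln 2 + 1) / ln (real n)))"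
    using eventually_ge_at_top[of "2 ^ m0"] eventually_ge_at_top[of 2]
    by (intro Limsup_mono, eventually_elim) (use bound in simp)
  also have "\<dots> = ereal a"
  proof (rule lim_imp_Limsup)
    have "(\<lambda>n. (a * (log 2 (real n) + 1) * ln 2 + 1) / ln (real n)) \<longlonglongrightarrow> a"
      unfolding log_def by real_asymp
    then show "(\<lambda>n. ereal ((a * (log 2 (real n) + 1) * ln 2 + 1) / ln (real n))) \<longlonglongrightarrow> ereal a"
      by simp
  qed simp
  finally show ?thesis .
qed

section \<open>The result for stationary processes\<close>

lemma process_law_shift_invariant:
  fixes X :: "nat \<Rightarrow> 'w \<Rightarrow> 'a::finite"
  assumes "stationary_process W X"
  shows "shift_invariant (process_law W X)"
proof -
  have prob: "prob_space W" and X: "\<And>n. X n \<in> W \<rightarrow>\<^sub>M count_space UNIV"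
    and stat: "\<And>t. process_law W (\<lambda>n. X (n + t)) = process_law W X"
    using assms by (auto simp: stationary_process_def)
  have m: "(\<lambda>w n. X n w) \<in> W \<rightarrow>\<^sub>M seq_space"
    by (rule measurable_abs_UNIV) (rule X)
  interpret prob_space W by fact
  interpret L: prob_space "process_law W X"
    unfolding process_law_def by (rule prob_space_distr[OF m])
  show ?thesis
  proof unfold_locales
    show "sets (process_law W X) = sets seq_space" by (simp add: process_law_def)
    show "distr (process_law W X) seq_space (\<lambda>x n. x (n + p)) = process_law W X" for p
    proof -
      have "distr (process_law W X) seq_space (\<lambda>x n. x (n + p)) = process_law W (\<lambda>n. X (n + p))"
        unfolding process_law_def by (subst distr_distr[OF measurable_shift m]) (simp add: comp_def)
      then show ?thesis by (simp only: stat)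
    qed
  qed
qed

theorem theorem2p5:
  fixes W :: "'w measure"
    and X :: "nat \<Rightarrow> 'w \<Rightarrow> 'a::finite"
    and \<mu> :: "(nat \<Rightarrow> 'a) measure"
  assumes "stationary_process W X"
    and "\<mu> = process_law W X"
    and "lower_renyi2 run_alphabet (rle_pushforward \<mu>) > 0"
    and "\<exists>c>0. \<exists>h>0. \<forall>n\<ge>1. \<forall>a. string_prob \<mu> (replicate n a) \<le> c * exp (- h * real n)"
  shows "AE (x, y) in \<mu> \<Otimes>\<^sub>M \<mu>.
           limsup (\<lambda>n. ereal (real (longest_common_rle n x y) / ln (real n)))
             \<le> 2 / lower_renyi2 run_alphabet (rle_pushforward \<mu>)"
proof -
  define H where "H = lower_renyi2 run_alphabet (rle_pushforward \<mu>)"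
  have H_pos: "H > 0" using assms(3) by (simp add: H_def)
  obtain c h where "c > 0" "h > 0"
    "\<And>n a. n \<ge> 1 \<Longrightarrow> string_prob \<mu> (replicate n a) \<le> c * exp (- h * real n)"
    using assms(4) by blast
  then interpret exp_bounded_law \<mu> c h
    using process_law_shift_invariant[OF assms(1)] assms(2)
    by (intro exp_bounded_law.intro exp_bounded_law_axioms.intro) auto
  let ?lim = "\<lambda>z. limsup (\<lambda>n. ereal (real (longest_common_rle n (fst z) (snd z)) / ln (real n)))"
  \<comment> \<open>\<open>H\<close> may be infinite, in which case \<open>2 / H = 0\<close>.
    Working with a real \<open>a\<close> above \<open>2 / H\<close> leaves room for a real
    \<open>t\<close> strictly between \<open>2 / a\<close> and \<open>H\<close>.\<close>
  have above: "AE z in \<mu> \<Otimes>\<^sub>M \<mu>. ?lim z \<le> ereal a" if a: "2 / H < ereal a" for a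
  proof -
    have "0 \<le> 2 / H" using H_pos by (cases H) auto
    then have "0 < ereal a" using a by (rule order_le_less_trans)
    then have a_pos: "a > 0" by simp
    have "ereal (2 / a) < H"
      using a a_pos H_pos by (cases H) (auto simp: field_simps)
    then obtain t where t: "ereal (2 / a) < ereal t" "ereal t < H"
      using ereal_dense2 by blast
    then have at: "a * t > 2" using a_pos by (simp add: field_simps)
    have t_pos: "t > 0" using t(1) a_pos by (simp add: order_less_trans[of 0 "2 / a"])
    have "\<forall>\<^sub>F k in sequentially. ereal t < ereal (- (1 / real k) * ln (collision_prob k))"
      using less_LiminfD[OF t(2)[unfolded H_def lower_renyi2_def]] .
    then have "\<forall>\<^sub>F k in sequentially. collision_prob k \<le> exp (- t * real k)"
      using eventually_gt_at_top[of 0]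
    proof eventually_elim
      case (elim k)
      show ?case
      \<comment> \<open>As \<open>ln 0 = 0\<close> by convention, the logarithmic bound says nothing
        about a vanishing collision probability, but then the claim is trivial.\<close>
      proof (cases "collision_prob k > 0")
        case True
        have "ln (collision_prob k) < - t * real k" using elim by (simp add: field_simps)
        then show ?thesis using True by (metis exp_ln exp_le_cancel_iff less_imp_le)
      qed (simp add: order_trans[OF _ less_imp_le[OF exp_gt_zero]])
    qed
    from AE_longest_common_rle_less[OF t_pos at this] show ?thesis
      by eventually_elim (rule limsup_longest_common_rle_le[OF a_pos])
  qed
  \<comment> \<open>The exceptional null set depends on \<open>a\<close>; rational values keep the
    union countable and still approximate \<open>2 / H\<close> from above.\<close>
  have "AE z in \<mu> \<Otimes>\<^sub>M \<mu>. \<forall>r :: rat. 2 / H < ereal (real_of_rat r) \<longrightarrow> ?lim z \<le> ereal (real_of_rat r)"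
    unfolding AE_all_countable using above by auto
  then have "AE z in \<mu> \<Otimes>\<^sub>M \<mu>. ?lim z \<le> 2 / H"
  proof eventually_elim
    case (elim z)
    show ?case
    proof (rule ccontr)
      assume "\<not> ?lim z \<le> 2 / H"
      then obtain r :: rat where "2 / H < real_of_rat r" "real_of_rat r < ?lim z"
        using ereal_dense3[of "2 / H" "?lim z"] by (force simp: not_le)
      then show False using elim by (auto simp: not_less[symmetric])
    qed
  qed
  then show ?thesis by (simp add: case_prod_beta H_def)
qed

end
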